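(* Assume that $U\subset\mathbb{R}^2$ is simply connected and bounded and that $X$ is the zero boundary condition Gaussian free field on $U$. Then there is a constant $C>0$ depending only on the domain $U$ such that for all $N\ge2$, $q_1,\dots,q_N\in\{-1,1\}$ and $x_1,\dots,x_N\in U$, $$-\sum_{1\le j<k\le N}q_jq_k\,\mathbb{E}X(x_j)X(x_k)\le\frac12\sum_{j=1}^N\log\left(\frac1{\frac12\min_{k\ne j}|x_j-x_k|}\right)+CN.$$
   Context: The zero boundary Gaussian free field on a bounded simply connected domain $U\subset\mathbb{R}^2=\mathbb{C}$ is the centered Gaussian random generalized function with covariance kernel $C_X(x,y)=\log\left|\frac{1-\varphi(x)\overline{\varphi(y)}}{\varphi(x)-\varphi(y)}\right|$, $x,y\in U$, where $\varphi:U\to\mathbb{D}$ is any conformal bijection onto the unit disc; $\mathbb{E}X(x)X(y)$ is notation for $C_X(x,y)$. If two of the points $x_j$ coincide the right-hand side is interpreted as $+\infty$ and the inequality as trivially true. *)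

theory Defs
  imports "HOL-Complex_Analysis.Complex_Analysis"
begin

definition conformal_bijection :: "(complex \<Rightarrow> complex) \<Rightarrow> complex set \<Rightarrow> complex set \<Rightarrow> bool" where
  "conformal_bijection \<phi> U V \<longleftrightarrow> \<phi> holomorphic_on U \<and> bij_betw \<phi> U V"

text \<open>
  Covariance kernel \<open>C\<^sub>X(x, y)\<close>, also written \<open>E X(x) X(y)\<close>, of the zero boundary Gaussian free
  field \<open>X\<close> on \<open>U\<close>, expressed through a conformal bijection \<open>\<phi>\<close> of \<open>U\<close> onto the unit disc.  The
  centered Gaussian field \<open>X\<close> is determined by this kernel.  The kernel does not depend on the choice
  of \<open>\<phi>\<close>: two choices differ by an automorphism of the disc, which preserves the modulus below.  The
  formula is meant for distinct \<open>x, y \<in> U\<close>; on the diagonal the kernel is infinite, whereas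
  the totalised division and logarithm return the junk value \<open>0\<close> there.
\<close>
definition gff_cov :: "(complex \<Rightarrow> complex) \<Rightarrow> complex \<Rightarrow> complex \<Rightarrow> real" where
  "gff_cov \<phi> x y = ln (cmod ((1 - \<phi> x * cnj (\<phi> y)) / (\<phi> x - \<phi> y)))"

end

theory Submission
  imports Defs "HOL-Real_Asymp.Real_Asymp"
begin

text \<open>
  The kernel is transported to the disc, where it is Green's function
  $G(z, w) = \ln|1 - z \bar w| - \ln|z - w|$, and the inequality is Onsager's electrostatic estimate.
  Replace the charge $q_j$ at $z_j = \phi(x_j)$ by the same charge spread evenly over a circle of
  radius $r_j$ around $z_j$.  If the circles are disjoint and stay inside the disc, the mean value
  property of $G$ leaves every mutual energy unchanged and turns the infinite self energy of the
  point $z_j$ into $\ln ((1 - |z_j|^2) / r_j)$.  Since $G$ is positive definite, the total energy is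
  nonnegative, which says that
  $-\sum_{j<k} q_j q_k G(z_j, z_k) \le \frac12 \sum_j \ln ((1 - |z_j|^2) / r_j)$; this is
  \<open>onsager_disc\<close>.

  Both positive definiteness and smearing can be had without integrals.
  With $\tau(z, w) = (1 - |z|^2)(1 - |w|^2) / |1 - z \bar w|^2$ one has $G = -\frac12 \ln (1 - \tau)$.
  The kernel $\tau$ is the Szego kernel times its conjugate times a rank-one factor, so its powers are
  positive definite, and therefore so is $-\frac12 \ln (1 - \kappa\tau) = \frac12 \sum_n \kappa^n \tau^n / n$
  for $0 \le \kappa < 1$, which in addition is finite on the diagonal (\<open>reg_green_psd\<close>).  The circles are
  replaced by $m$ equally spaced points.  Averages of $\ln|\alpha - \beta\omega|$ over the $m$-th roots
  of unity $\omega$ are explicit because $\prod_\omega (\alpha - \beta\omega) = \alpha^m - \beta^m$,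
  so that as $m \to \infty$ and $\kappa = 1 - m^{-3} \to 1$ the energies of the discrete charges converge
  to those of the circles (\<open>circle_energy_distinct\<close>, \<open>circle_energy_self\<close>).

  It remains to compare the radii in the disc with the distances in $U$.  Take
  $r_j = \frac12 \min (\frac12 \min_{k \ne j} |z_j - z_k|, 1 - |z_j|)$.  As $U$ is bounded, say of diameter
  less than $D$, the Schwarz lemma for $\phi^{-1}$ on the disc of radius $1 - |z_j|$ around $z_j$ gives
  $|x_j - x_k| (1 - |z_j|) \le D |z_j - z_k|$ (\<open>conformal_bijection_distortion\<close>).  Hence
  $(1 - |z_j|^2) / r_j$ is at most $8 D$ divided by half the distance from $x_j$ to the nearest other
  point, and the constant $\frac12 \ln (8 D)$ works.
\<close>

section \<open>Positive semidefinite kernels on the unit disc\<close>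

text \<open>
  The index set is kept apart from the points of the disc so that a kernel can be twisted by arbitrary
  functions of the index.  Only the real part of the quadratic form is constrained, which is all that
  the final real kernel needs and which spares all statements about Hermitian symmetry.
\<close>

definition psd_on :: "'i set \<Rightarrow> ('i \<Rightarrow> 'i \<Rightarrow> complex) \<Rightarrow> bool" where
  "psd_on A K \<longleftrightarrow> (\<forall>c. 0 \<le> Re (\<Sum>i\<in>A. \<Sum>k\<in>A. c i * cnj (c k) * K i k))"

lemma psd_on_one: "psd_on A (\<lambda>i k. 1)"
proof -
  have "(\<Sum>i\<in>A. \<Sum>k\<in>A. c i * cnj (c k)) = of_real ((cmod (\<Sum>i\<in>A. c i))\<^sup>2)" for c
    by (simp only: complex_norm_square sum_product cnj_sum)
  then show ?thesis
    by (simp add: psd_on_def)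
qed

lemma psd_on_twist:
  assumes "psd_on A K"
  shows "psd_on A (\<lambda>i k. f i * cnj (f k) * K i k)"
  unfolding psd_on_def
proof
  fix c
  have "c i * cnj (c k) * (f i * cnj (f k) * K i k) = (c i * f i) * cnj (c k * f k) * K i k" for i k
    by simp
  with assms show "0 \<le> Re (\<Sum>i\<in>A. \<Sum>k\<in>A. c i * cnj (c k) * (f i * cnj (f k) * K i k))"
    by (simp only: psd_on_def)
qed

lemma psd_on_scale:
  assumes "psd_on A K" "0 \<le> a"
  shows "psd_on A (\<lambda>i k. of_real a * K i k)"
proof -
  have "complex_of_real (sqrt a) * cnj (complex_of_real (sqrt a)) = of_real a"
    using assms(2) by (simp flip: of_real_mult)
  with psd_on_twist[OF assms(1), of "\<lambda>_. of_real (sqrt a)"] show ?thesis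
    by (simp only:)
qed

lemma psd_on_sums:
  assumes "\<And>n. psd_on A (K n)"
    and "\<And>i k. i \<in> A \<Longrightarrow> k \<in> A \<Longrightarrow> (\<lambda>n. K n i k) sums L i k"
  shows "psd_on A L"
  unfolding psd_on_def
proof
  fix c
  have "(\<lambda>n. \<Sum>i\<in>A. \<Sum>k\<in>A. c i * cnj (c k) * K n i k) sums
      (\<Sum>i\<in>A. \<Sum>k\<in>A. c i * cnj (c k) * L i k)"
    by (intro sums_sum sums_mult assms(2))
  then have lim: "(\<lambda>n. Re (\<Sum>i\<in>A. \<Sum>k\<in>A. c i * cnj (c k) * K n i k)) sums
      Re (\<Sum>i\<in>A. \<Sum>k\<in>A. c i * cnj (c k) * L i k)"
    by (rule sums_Re)
  have nonneg: "0 \<le> Re (\<Sum>i\<in>A. \<Sum>k\<in>A. c i * cnj (c k) * K n i k)" for n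
    using assms(1)[unfolded psd_on_def] by (rule spec)
  show "0 \<le> Re (\<Sum>i\<in>A. \<Sum>k\<in>A. c i * cnj (c k) * L i k)"
    by (rule sums_le[OF nonneg sums_zero lim])
qed

text \<open>
  Multiplication by the Szego kernel is, by the geometric series, a sum of twists by the functions
  $z^n$.  In this way products with the kernels used below are positive semidefinite without an appeal
  to the Schur product theorem.
\<close>

lemma psd_on_szego:
  assumes "psd_on A K" and z: "\<And>i. i \<in> A \<Longrightarrow> cmod (z i) < 1"
  shows "psd_on A (\<lambda>i k. K i k / (1 - z i * cnj (z k)))"
proof (rule psd_on_sums)
  show "psd_on A (\<lambda>i k. z i ^ n * cnj (z k ^ n) * K i k)" for n
    by (rule psd_on_twist) fact
  fix i k assume "i \<in> A" "k \<in> A"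
  then have "cmod (z i * cnj (z k)) < 1"
    using z[of i] z[of k] mult_strict_mono'[of "cmod (z i)" 1 "cmod (z k)" 1]
    by (simp add: norm_mult)
  then have "(\<lambda>n. K i k * (z i * cnj (z k)) ^ n) sums (K i k * (1 / (1 - z i * cnj (z k))))"
    by (intro sums_mult geometric_sums)
  then show "(\<lambda>n. z i ^ n * cnj (z k ^ n) * K i k) sums (K i k / (1 - z i * cnj (z k)))"
    by (simp add: power_mult_distrib mult_ac)
qed

text \<open>
  This is $1 - \rho(z, w)^2$ for the pseudohyperbolic distance $\rho$, that is
  $1 / \cosh^2 (d / 2)$ for the hyperbolic distance $d$ of curvature $-1$.
\<close>

definition sech_sq :: "complex \<Rightarrow> complex \<Rightarrow> real" where
  "sech_sq z w = (1 - (cmod z)\<^sup>2) * (1 - (cmod w)\<^sup>2) / (cmod (1 - z * cnj w))\<^sup>2"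

lemma cmod_one_minus_mult_cnj_sq:
  "(cmod (1 - z * cnj w))\<^sup>2 = (cmod (z - w))\<^sup>2 + (1 - (cmod z)\<^sup>2) * (1 - (cmod w)\<^sup>2)"
  by (simp add: cmod_power2) algebra

lemma one_minus_mult_cnj_bound:
  assumes "cmod w \<le> 1"
  shows "1 - cmod z \<le> cmod (1 - z * cnj w)"
proof -
  have "cmod (z * cnj w) \<le> cmod z"
    using assms by (simp add: norm_mult mult_left_le)
  then show ?thesis
    using norm_triangle_ineq2[of 1 "z * cnj w"] by simp
qed

lemma one_minus_mult_cnj_pos:
  assumes "cmod z < 1" "cmod w < 1"
  shows "0 < cmod (1 - z * cnj w)"
  using one_minus_mult_cnj_bound[of w z] assms by linarith

lemma sech_sq_bounds:
  assumes "cmod z < 1" "cmod w < 1"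
  shows "0 \<le> sech_sq z w" "sech_sq z w \<le> 1"
proof -
  have "(cmod z)\<^sup>2 \<le> 1" "(cmod w)\<^sup>2 \<le> 1"
    using assms by (simp_all add: power_le_one)
  then show "0 \<le> sech_sq z w"
    by (simp add: sech_sq_def)
  have "(1 - (cmod z)\<^sup>2) * (1 - (cmod w)\<^sup>2) \<le> (cmod (1 - z * cnj w))\<^sup>2"
    unfolding cmod_one_minus_mult_cnj_sq by simp
  then show "sech_sq z w \<le> 1"
    unfolding sech_sq_def using one_minus_mult_cnj_pos[OF assms] by (subst pos_divide_le_eq) auto
qed

text \<open>
  The denominator of \<open>sech_sq\<close> is a product of a Szego denominator and its conjugate, and the
  conjugate is the Szego denominator of the conjugate points; each further power therefore costs two
  applications of \<open>psd_on_szego\<close> and one twist by the numerator.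
\<close>

lemma psd_on_sech_sq_power:
  assumes z: "\<And>i. i \<in> A \<Longrightarrow> cmod (z i) < 1"
  shows "psd_on A (\<lambda>i k. of_real (sech_sq (z i) (z k) ^ n))"
proof (induction n)
  case 0
  then show ?case by (simp add: psd_on_one)
next
  case (Suc n)
  define f where "f i = complex_of_real (1 - (cmod (z i))\<^sup>2)" for i
  let ?K = "\<lambda>i k. complex_of_real (sech_sq (z i) (z k) ^ n)"
  have "psd_on A (\<lambda>i k. f i * cnj (f k) * ?K i k)"
    using Suc by (rule psd_on_twist)
  then have "psd_on A (\<lambda>i k. f i * cnj (f k) * ?K i k / (1 - z i * cnj (z k)))"
    by (rule psd_on_szego) (rule z)
  then have "psd_on A (\<lambda>i k. f i * cnj (f k) * ?K i k / (1 - z i * cnj (z k))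
      / (1 - cnj (z i) * cnj (cnj (z k))))"
    by (rule psd_on_szego[where z = "\<lambda>i. cnj (z i)"]) (simp add: z)
  moreover have "complex_of_real (sech_sq (z i) (z k) ^ Suc n) =
      (f i * cnj (f k) * ?K i k) / (1 - z i * cnj (z k)) / (1 - cnj (z i) * cnj (cnj (z k)))" for i k
    by (simp add: sech_sq_def f_def complex_norm_square del: of_real_power)
  ultimately show ?case by (simp only:)
qed

text \<open>
  For $\kappa = 1$ and off the diagonal this is Green's function of the disc; for $\kappa < 1$ it is bounded.
\<close>

definition reg_green :: "real \<Rightarrow> complex \<Rightarrow> complex \<Rightarrow> real" where
  "reg_green \<kappa> z w = - ln (1 - \<kappa> * sech_sq z w) / 2"

text \<open>
  All coefficients of the power series of the negative logarithm are nonnegative.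
\<close>

lemma reg_green_psd:
  assumes z: "\<And>i. i \<in> A \<Longrightarrow> cmod (z i) < 1" and \<kappa>: "0 \<le> \<kappa>" "\<kappa> < 1"
  shows "0 \<le> (\<Sum>i\<in>A. \<Sum>k\<in>A. c i * c k * reg_green \<kappa> (z i) (z k))"
proof -
  have "psd_on A (\<lambda>i k. of_real (reg_green \<kappa> (z i) (z k)))"
  proof (rule psd_on_sums)
    show "psd_on A (\<lambda>i k. of_real (\<kappa> ^ n / (2 * real n)) * of_real (sech_sq (z i) (z k) ^ n))" for n
      using \<kappa> by (intro psd_on_scale[where a = "\<kappa> ^ n / (2 * real n)"] psd_on_sech_sq_power[OF z]) auto
    fix i k assume "i \<in> A" "k \<in> A"
    then have "0 \<le> sech_sq (z i) (z k)" "sech_sq (z i) (z k) \<le> 1"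
      using sech_sq_bounds z by auto
    then have "\<kappa> * sech_sq (z i) (z k) \<le> \<kappa>" "0 \<le> \<kappa> * sech_sq (z i) (z k)"
      using \<kappa> by (auto simp: mult_left_le)
    then have "(\<lambda>n. - ((\<kappa> * sech_sq (z i) (z k)) ^ n) / of_nat n) sums ln (1 - \<kappa> * sech_sq (z i) (z k))"
      using ln_series'[of "- (\<kappa> * sech_sq (z i) (z k))"] \<kappa> by auto
    from sums_mult[OF this, of "-1/2"]
    have "(\<lambda>n. \<kappa> ^ n / (2 * real n) * sech_sq (z i) (z k) ^ n) sums reg_green \<kappa> (z i) (z k)"
      by (simp add: reg_green_def power_mult_distrib field_simps)
    then show "(\<lambda>n. of_real (\<kappa> ^ n / (2 * real n)) * of_real (sech_sq (z i) (z k) ^ n)) sums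
        complex_of_real (reg_green \<kappa> (z i) (z k))"
      unfolding of_real_mult[symmetric] by (simp only: sums_of_real_iff)
  qed
  then have "0 \<le> Re (\<Sum>i\<in>A. \<Sum>k\<in>A. of_real (c i) * cnj (of_real (c k)) * of_real (reg_green \<kappa> (z i) (z k)))"
    unfolding psd_on_def by (rule spec)
  then show ?thesis by simp
qed

section \<open>Products over the roots of unity\<close>

definition unity_roots :: "nat \<Rightarrow> complex set" where
  "unity_roots m = {\<omega>. \<omega> ^ m = 1}"

lemma finite_unity_roots [simp]: "0 < m \<Longrightarrow> finite (unity_roots m)"
  by (simp add: unity_roots_def finite_roots_unity)

lemma card_unity_roots [simp]: "0 < m \<Longrightarrow> card (unity_roots m) = m"
  by (simp add: unity_roots_def card_roots_unity_eq)

lemma norm_unity_roots: "0 < m \<Longrightarrow> \<omega> \<in> unity_roots m \<Longrightarrow> cmod \<omega> = 1"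
  by (metis (mono_tags, lifting) mem_Collect_eq norm_ge_zero norm_one norm_power power_eq_1_iff unity_roots_def bot_nat_0.not_eq_extremum)

lemma prod_unity_roots_poly:
  assumes "0 < m"
  shows "(\<Prod>\<omega>\<in>unity_roots m. [:-\<omega>, 1:]) = monom 1 m - 1"
proof (rule poly_eqI_degree_lead_coeff[where n = m and A = "unity_roots m"])
  have deg: "degree (\<Prod>\<omega>\<in>unity_roots m. [:-\<omega>, 1:]) = m"
    using assms by (subst degree_prod_eq_sum_degree) auto
  have "lead_coeff (\<Prod>\<omega>\<in>unity_roots m. [:-\<omega>, 1:]) = 1"
    by (simp add: lead_coeff_prod)
  then show "poly.coeff (\<Prod>\<omega>\<in>unity_roots m. [:-\<omega>, 1:]) m = poly.coeff (monom 1 m - 1) m"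
    using assms by (simp add: deg)
  show "degree (\<Prod>\<omega>\<in>unity_roots m. [:-\<omega>, 1:]) \<le> m" by (simp add: deg)
  show "degree (monom (1::complex) m - 1) \<le> m"
    by (intro degree_diff_le) (auto simp: degree_monom_le)
  show "poly (\<Prod>\<omega>\<in>unity_roots m. [:-\<omega>, 1:]) z = poly (monom 1 m - 1) z" if "z \<in> unity_roots m" for z
  proof -
    have "poly (\<Prod>\<omega>\<in>unity_roots m. [:-\<omega>, 1:]) z = 0"
      using that assms by (auto simp: poly_prod intro!: prod_zero)
    then show ?thesis using that by (simp add: poly_monom unity_roots_def)
  qed
qed (use assms in auto)

lemma prod_minus_unity_roots:
  assumes "0 < m"
  shows "(\<Prod>\<omega>\<in>unity_roots m. x - y * \<omega>) = x ^ m - y ^ m"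
proof (cases "y = 0")
  case True
  then show ?thesis using assms by simp
next
  case False
  have "(\<Prod>\<omega>\<in>unity_roots m. x - y * \<omega>) = (\<Prod>\<omega>\<in>unity_roots m. y * (x / y - \<omega>))"
    using False by (intro prod.cong) (auto simp: field_simps)
  also have "\<dots> = y ^ m * (\<Prod>\<omega>\<in>unity_roots m. x / y - \<omega>)"
    using assms by (simp add: prod.distrib)
  also have "(\<Prod>\<omega>\<in>unity_roots m. x / y - \<omega>) = poly (monom 1 m - 1) (x / y)"
    by (simp add: poly_prod flip: prod_unity_roots_poly[OF assms])
  also have "y ^ m * \<dots> = x ^ m - y ^ m"
    using False by (simp add: poly_monom field_simps)
  finally show ?thesis .
qed

text \<open>
  The product is the value at $1$ of $(X^m - 1) / (X - 1)$, that is, of the derivative of $X^m - 1$.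
\<close>

lemma prod_one_minus_unity_roots:
  assumes "0 < m"
  shows "(\<Prod>\<omega>\<in>unity_roots m - {1}. 1 - \<omega>) = of_nat m"
proof -
  let ?P = "\<Prod>\<omega>\<in>unity_roots m - {1}. [:-\<omega>, 1:]"
  have one: "1 \<in> unity_roots m" by (simp add: unity_roots_def)
  have "[:-1, 1:] * ?P = monom 1 m - 1"
    using prod_unity_roots_poly[OF assms] prod.remove[OF finite_unity_roots[OF assms] one, of "\<lambda>\<omega>. [:-\<omega>, 1:]"]
    by simp
  then have "pderiv ([:-1, 1:] * ?P) = pderiv (monom 1 m - 1)" by simp
  then have "poly (pderiv ([:-1, 1:] * ?P)) 1 = poly (pderiv (monom 1 m - 1)) 1" by simp
  then show ?thesis
    by (simp add: pderiv_mult pderiv_diff pderiv_monom poly_monom poly_prod pderiv_pCons)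
qed

lemma prod_diff_unity_roots:
  assumes "0 < m" "\<alpha> \<in> unity_roots m"
  shows "(\<Prod>\<omega>\<in>unity_roots m - {\<alpha>}. cmod (\<alpha> - \<omega>)) = real m"
proof -
  have nz: "\<alpha> \<noteq> 0" and n1: "cmod \<alpha> = 1"
    using norm_unity_roots[OF assms] by auto
  have \<alpha>: "\<alpha> ^ m = 1" using assms by (simp add: unity_roots_def)
  have "bij_betw (\<lambda>\<omega>. \<alpha> * \<omega>) (unity_roots m - {1}) (unity_roots m - {\<alpha>})"
    by (rule bij_betwI[where g = "\<lambda>\<omega>. \<omega> / \<alpha>"])
       (use nz \<alpha> in \<open>auto simp: unity_roots_def power_mult_distrib power_divide\<close>)
  then have "(\<Prod>\<omega>\<in>unity_roots m - {\<alpha>}. cmod (\<alpha> - \<omega>)) = (\<Prod>\<omega>\<in>unity_roots m - {1}. cmod (\<alpha> - \<alpha> * \<omega>))"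
    by (rule prod.reindex_bij_betw[symmetric])
  also have "\<dots> = (\<Prod>\<omega>\<in>unity_roots m - {1}. cmod (1 - \<omega>))"
    by (intro prod.cong refl) (metis mult.right_neutral mult_cancel_right1 norm_mult n1 right_diff_distrib)
  also have "\<dots> = cmod (of_nat m)"
    by (simp add: prod_norm flip: prod_one_minus_unity_roots[OF assms(1)])
  finally show ?thesis by simp
qed

text \<open>
  If the quotient $\zeta \ne 1$ of the two roots were too close to $1$, then all its powers
  $\zeta^k$ with $k < m$ would lie near $1$, whereas they add up to $0$.  The polynomial rate in $m$ is
  what the limit of \<open>circle_energy_self\<close> relies on.
\<close>

lemma unity_roots_gap:
  assumes "0 < m" "\<alpha> \<in> unity_roots m" "\<beta> \<in> unity_roots m" "\<alpha> \<noteq> \<beta>"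
  shows "1 / real m \<le> cmod (\<alpha> - \<beta>)"
proof -
  define \<zeta> where "\<zeta> = \<alpha> / \<beta>"
  have n: "cmod \<alpha> = 1" "cmod \<beta> = 1" using assms norm_unity_roots by auto
  have nz: "\<beta> \<noteq> 0" using n by auto
  have "\<zeta> ^ m = 1" "\<zeta> \<noteq> 1"
    using assms nz by (auto simp: \<zeta>_def unity_roots_def power_divide)
  have nz1: "cmod \<zeta> = 1" by (simp add: \<zeta>_def norm_divide n)
  have "(1 - \<zeta>) * (\<Sum>k<m. \<zeta> ^ k) = 0"
    using \<open>\<zeta> ^ m = 1\<close> by (simp flip: one_diff_power_eq)
  then have s0: "(\<Sum>k<m. \<zeta> ^ k) = 0" using \<open>\<zeta> \<noteq> 1\<close> by simp
  have step: "cmod (1 - \<zeta> ^ k) \<le> real m * cmod (1 - \<zeta>)" if "k < m" for k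
  proof -
    have "cmod (\<Sum>i<k. \<zeta> ^ i) \<le> (\<Sum>i<k. 1)"
      by (rule order_trans[OF norm_sum]) (simp add: norm_power nz1)
    then have "cmod (1 - \<zeta>) * cmod (\<Sum>i<k. \<zeta> ^ i) \<le> cmod (1 - \<zeta>) * real m"
      using that by (intro mult_left_mono) auto
    then show ?thesis by (simp add: one_diff_power_eq norm_mult mult.commute)
  qed
  have "real m = cmod (\<Sum>k<m. 1 - \<zeta> ^ k)"
    by (simp add: sum_subtractf s0)
  also have "\<dots> \<le> (\<Sum>k<m. real m * cmod (1 - \<zeta>))"
    by (rule order_trans[OF norm_sum]) (intro sum_mono step, simp)
  finally have "1 \<le> real m * cmod (1 - \<zeta>)" using assms(1) by simp
  moreover have "cmod (\<alpha> - \<beta>) = cmod (1 - \<zeta>)"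
  proof -
    have "\<alpha> - \<beta> = - \<beta> * (1 - \<zeta>)" using nz by (simp add: \<zeta>_def field_simps)
    then show ?thesis by (simp only: norm_mult norm_minus_cancel n)
  qed
  ultimately show ?thesis using assms(1) by (simp add: field_simps)
qed

section \<open>Logarithmic averages over circles\<close>

text \<open>
  A discrete mean value property: the sum is $\ln |\alpha^m - \beta^m|$, and the factor
  $|1 - (\beta/\alpha)^m|$ lies between $1/2$ and $2$.  The error of the average is thus of order
  $1/m$, uniformly in the circle.
\<close>

lemma sum_ln_circle_bound:
  assumes "0 < m" "\<alpha> \<noteq> 0" "2 * cmod \<beta> \<le> cmod \<alpha>"
  shows "\<bar>(\<Sum>\<omega>\<in>unity_roots m. ln (cmod (\<alpha> - \<beta> * \<omega>))) - real m * ln (cmod \<alpha>)\<bar> \<le> 1"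
proof -
  define x where "x = (\<beta> / \<alpha>) ^ m"
  have "cmod (\<beta> / \<alpha>) \<le> 1 / 2"
    using assms by (simp add: norm_divide field_simps)
  then have x: "cmod x \<le> 1 / 2"
    using power_decreasing[of 1 m "cmod (\<beta> / \<alpha>)"] assms(1) by (simp add: x_def norm_power)
  have lb: "1 / 2 \<le> cmod (1 - x)" and ub: "cmod (1 - x) \<le> 2"
    using norm_triangle_ineq2[of 1 x] norm_triangle_ineq4[of 1 x] x by simp_all
  have "ln (1 / 2) \<le> ln (cmod (1 - x))" "ln (cmod (1 - x)) \<le> ln 2"
    by (rule ln_mono, use lb ub in auto)+
  then have small: "\<bar>ln (cmod (1 - x))\<bar> \<le> 1"
    using ln_2_less_1 by (simp add: ln_div)
  have nz: "\<alpha> - \<beta> * \<omega> \<noteq> 0" if "\<omega> \<in> unity_roots m" for \<omega>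
  proof
    assume "\<alpha> - \<beta> * \<omega> = 0"
    then have "cmod \<alpha> = cmod \<beta>"
      using norm_unity_roots[OF assms(1) that] by (simp add: norm_mult)
    then show False using assms by simp
  qed
  have "(\<Sum>\<omega>\<in>unity_roots m. ln (cmod (\<alpha> - \<beta> * \<omega>))) = ln (\<Prod>\<omega>\<in>unity_roots m. cmod (\<alpha> - \<beta> * \<omega>))"
    using assms(1) nz by (subst ln_prod) auto
  also have "(\<Prod>\<omega>\<in>unity_roots m. cmod (\<alpha> - \<beta> * \<omega>)) = cmod (\<alpha> ^ m * (1 - x))"
  proof -
    have "\<alpha> ^ m * (1 - x) = \<alpha> ^ m - \<beta> ^ m"
      using assms(2) by (simp add: x_def power_divide right_diff_distrib)
    then show ?thesis
      by (simp only: prod_norm prod_minus_unity_roots[OF assms(1)])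
  qed
  also have "ln \<dots> = real m * ln (cmod \<alpha>) + ln (cmod (1 - x))"
  proof -
    have pos: "0 < cmod \<alpha> ^ m" "0 < cmod (1 - x)"
      using lb assms(2) by (simp, linarith)
    show ?thesis
      using assms(2) by (simp only: norm_mult norm_power ln_mult_pos[OF pos]) (simp add: ln_realpow)
  qed
  finally show ?thesis using small by simp
qed

lemma double_sum_bound:
  fixes F :: "complex \<Rightarrow> complex \<Rightarrow> real"
  assumes m: "0 < m"
    and inner: "\<And>\<beta>. \<beta> \<in> unity_roots m \<Longrightarrow> \<bar>(\<Sum>\<alpha>\<in>unity_roots m. F \<alpha> \<beta>) - real m * g \<beta>\<bar> \<le> 1"
    and outer: "\<bar>(\<Sum>\<beta>\<in>unity_roots m. g \<beta>) - real m * h\<bar> \<le> 1"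
  shows "\<bar>(\<Sum>\<alpha>\<in>unity_roots m. \<Sum>\<beta>\<in>unity_roots m. F \<alpha> \<beta>) - (real m)\<^sup>2 * h\<bar> \<le> 2 * real m"
proof -
  let ?R = "unity_roots m"
  have "(\<Sum>\<alpha>\<in>?R. \<Sum>\<beta>\<in>?R. F \<alpha> \<beta>) - (real m)\<^sup>2 * h =
      (\<Sum>\<beta>\<in>?R. (\<Sum>\<alpha>\<in>?R. F \<alpha> \<beta>) - real m * g \<beta>) + real m * ((\<Sum>\<beta>\<in>?R. g \<beta>) - real m * h)"
    by (subst sum.swap) (simp add: sum_subtractf sum_distrib_left power2_eq_square algebra_simps)
  moreover have "\<bar>\<Sum>\<beta>\<in>?R. (\<Sum>\<alpha>\<in>?R. F \<alpha> \<beta>) - real m * g \<beta>\<bar> \<le> (\<Sum>\<beta>\<in>?R. 1)"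
    by (rule order_trans[OF sum_abs]) (intro sum_mono inner)
  moreover have "\<bar>real m * ((\<Sum>\<beta>\<in>?R. g \<beta>) - real m * h)\<bar> \<le> real m * 1"
    unfolding abs_mult using outer by (intro mult_mono) auto
  ultimately show ?thesis using m by simp
qed

lemma circle_in_disc:
  assumes "0 < m" "0 \<le> r" "2 * r \<le> 1 - cmod z" "cmod z < 1" "\<omega> \<in> unity_roots m"
  shows "cmod (z + of_real r * \<omega>) \<le> 1 - (1 - cmod z) / 2"
    and "cmod (z + of_real r * \<omega>) < 1"
proof -
  show "cmod (z + of_real r * \<omega>) \<le> 1 - (1 - cmod z) / 2"
    using norm_triangle_ineq[of z "of_real r * \<omega>"] norm_unity_roots[OF assms(1,5)] assms(2,3)
    by (simp add: norm_mult field_simps)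
  also have "\<dots> < 1" using assms(4) by simp
  finally show "cmod (z + of_real r * \<omega>) < 1" .
qed

text \<open>
  The mean value property in $z$ and then in $w$.  The two circles may coincide here: the function
  $1 - z \bar w$ has no zero in the bidisc.
\<close>

lemma sum_ln_image_bound:
  assumes m: "0 < m" and z: "cmod z < 1" "0 \<le> r" "2 * r \<le> 1 - cmod z"
    and w: "cmod w < 1" "0 \<le> s" "2 * s \<le> 1 - cmod w"
  shows "\<bar>(\<Sum>\<alpha>\<in>unity_roots m. \<Sum>\<beta>\<in>unity_roots m.
      ln (cmod (1 - (z + of_real r * \<alpha>) * cnj (w + of_real s * \<beta>))))
      - (real m)\<^sup>2 * ln (cmod (1 - z * cnj w))\<bar> \<le> 2 * real m"
proof (rule double_sum_bound[OF m, where g = "\<lambda>\<beta>. ln (cmod (1 - z * cnj (w + of_real s * \<beta>)))"])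
  fix \<beta> assume \<beta>: "\<beta> \<in> unity_roots m"
  define p where "p = w + of_real s * \<beta>"
  have p: "cmod p < 1"
    unfolding p_def by (rule circle_in_disc[OF m w(2,3,1) \<beta>])
  have "2 * cmod (of_real r * cnj p) \<le> 2 * r"
    using p z by (simp add: norm_mult mult_left_le)
  then have "2 * cmod (of_real r * cnj p) \<le> cmod (1 - z * cnj p)"
    using one_minus_mult_cnj_bound[of p z] p z by simp
  moreover have "1 - z * cnj p \<noteq> 0"
    using one_minus_mult_cnj_pos[OF z(1) p] by auto
  ultimately have "\<bar>(\<Sum>\<alpha>\<in>unity_roots m. ln (cmod ((1 - z * cnj p) - (of_real r * cnj p) * \<alpha>)))
      - real m * ln (cmod (1 - z * cnj p))\<bar> \<le> 1"
    by (intro sum_ln_circle_bound m)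
  moreover have "(1 - z * cnj p) - (of_real r * cnj p) * \<alpha> = 1 - (z + of_real r * \<alpha>) * cnj p" for \<alpha>
    by (simp add: algebra_simps)
  ultimately show "\<bar>(\<Sum>\<alpha>\<in>unity_roots m. ln (cmod (1 - (z + of_real r * \<alpha>) * cnj (w + of_real s * \<beta>))))
      - real m * ln (cmod (1 - z * cnj (w + of_real s * \<beta>)))\<bar> \<le> 1"
    by (simp only: p_def)
next
  have conj: "cmod (1 - z * cnj p) = cmod (1 - p * cnj z)" for p
    using complex_mod_cnj[of "1 - z * cnj p"] by (simp add: mult.commute)
  have "2 * cmod (of_real s * cnj z) \<le> 2 * s"
    using z w by (simp add: norm_mult mult_left_le)
  then have "2 * cmod (of_real s * cnj z) \<le> cmod (1 - w * cnj z)"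
    using one_minus_mult_cnj_bound[of z w] z w by simp
  moreover have "1 - w * cnj z \<noteq> 0"
    using one_minus_mult_cnj_pos[OF w(1) z(1)] by auto
  ultimately have "\<bar>(\<Sum>\<beta>\<in>unity_roots m. ln (cmod ((1 - w * cnj z) - (of_real s * cnj z) * \<beta>)))
      - real m * ln (cmod (1 - w * cnj z))\<bar> \<le> 1"
    by (intro sum_ln_circle_bound m)
  moreover have "(1 - w * cnj z) - (of_real s * cnj z) * \<beta> = 1 - (w + of_real s * \<beta>) * cnj z" for \<beta>
    by (simp add: algebra_simps)
  ultimately show "\<bar>(\<Sum>\<beta>\<in>unity_roots m. ln (cmod (1 - z * cnj (w + of_real s * \<beta>))))
      - real m * ln (cmod (1 - z * cnj w))\<bar> \<le> 1"
    by (simp only: conj)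
qed

lemma sum_ln_dist_bound:
  assumes m: "0 < m" and r: "0 \<le> r" and s: "0 \<le> s"
    and sep: "z \<noteq> w" "2 * (r + s) \<le> cmod (z - w)"
  shows "\<bar>(\<Sum>\<alpha>\<in>unity_roots m. \<Sum>\<beta>\<in>unity_roots m.
      ln (cmod ((z + of_real r * \<alpha>) - (w + of_real s * \<beta>))))
      - (real m)\<^sup>2 * ln (cmod (z - w))\<bar> \<le> 2 * real m"
proof (rule double_sum_bound[OF m, where g = "\<lambda>\<beta>. ln (cmod ((z - w) - of_real s * \<beta>))"])
  fix \<beta> assume \<beta>: "\<beta> \<in> unity_roots m"
  define p where "p = (z - w) - of_real s * \<beta>"
  have pos: "0 < cmod (z - w)" using sep by simp
  have p: "cmod (z - w) - s \<le> cmod p"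
    using norm_triangle_ineq2[of "z - w" "of_real s * \<beta>"] norm_unity_roots[OF m \<beta>] s
    by (simp add: p_def norm_mult)
  have "2 * s \<le> cmod (z - w)" using sep(2) r by (simp add: distrib_left)
  then have "0 < cmod p" using p pos by linarith
  then have "p \<noteq> 0" by simp
  moreover have "2 * cmod (- of_real r) \<le> cmod p"
    using p pos sep(2) r s by simp
  ultimately have "\<bar>(\<Sum>\<alpha>\<in>unity_roots m. ln (cmod (p - (- of_real r) * \<alpha>))) - real m * ln (cmod p)\<bar> \<le> 1"
    by (intro sum_ln_circle_bound m)
  moreover have "p - (- of_real r) * \<alpha> = (z + of_real r * \<alpha>) - (w + of_real s * \<beta>)" for \<alpha>
    by (simp add: p_def algebra_simps)
  ultimately show "\<bar>(\<Sum>\<alpha>\<in>unity_roots m. ln (cmod ((z + of_real r * \<alpha>) - (w + of_real s * \<beta>))))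
      - real m * ln (cmod ((z - w) - of_real s * \<beta>))\<bar> \<le> 1"
    by (simp only: p_def)
next
  show "\<bar>(\<Sum>\<beta>\<in>unity_roots m. ln (cmod ((z - w) - of_real s * \<beta>))) - real m * ln (cmod (z - w))\<bar> \<le> 1"
    using sep r s by (intro sum_ln_circle_bound m) auto
qed

text \<open>
  The self energy of $m$ equally spaced charges is known exactly, since the distances from one $m$-th
  root of unity to the others multiply to $m$.
\<close>

lemma sum_ln_self_dist:
  assumes m: "0 < m" and r: "0 < r"
  shows "(\<Sum>\<alpha>\<in>unity_roots m. \<Sum>\<beta>\<in>unity_roots m - {\<alpha>}.
      ln (cmod ((z + of_real r * \<alpha>) - (z + of_real r * \<beta>))))
      = real m * ((real m - 1) * ln r + ln (real m))"
proof -
  have "(\<Sum>\<beta>\<in>unity_roots m - {\<alpha>}. ln (cmod ((z + of_real r * \<alpha>) - (z + of_real r * \<beta>))))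
      = (real m - 1) * ln r + ln (real m)" if \<alpha>: "\<alpha> \<in> unity_roots m" for \<alpha>
  proof -
    have "cmod ((z + of_real r * \<alpha>) - (z + of_real r * \<beta>)) = r * cmod (\<alpha> - \<beta>)" for \<beta>
      using r by (simp flip: right_diff_distrib add: norm_mult)
    then have "(\<Sum>\<beta>\<in>unity_roots m - {\<alpha>}. ln (cmod ((z + of_real r * \<alpha>) - (z + of_real r * \<beta>))))
        = (\<Sum>\<beta>\<in>unity_roots m - {\<alpha>}. ln r + ln (cmod (\<alpha> - \<beta>)))"
      using r by (intro sum.cong) (auto simp: ln_mult)
    also have "\<dots> = (real m - 1) * ln r + ln (\<Prod>\<beta>\<in>unity_roots m - {\<alpha>}. cmod (\<alpha> - \<beta>))"
      using m \<alpha> by (subst ln_prod) (auto simp: sum.distrib card_Diff_singleton of_nat_diff Suc_le_eq)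
    finally show ?thesis by (simp add: prod_diff_unity_roots[OF m \<alpha>])
  qed
  then show ?thesis using m by simp
qed

definition green :: "complex \<Rightarrow> complex \<Rightarrow> real" where
  "green z w = ln (cmod (1 - z * cnj w)) - ln (cmod (z - w))"

lemma reg_green_diag:
  assumes "cmod z < 1"
  shows "reg_green \<kappa> z z = - ln (1 - \<kappa>) / 2"
proof -
  have "(cmod (1 - z * cnj z))\<^sup>2 = (1 - (cmod z)\<^sup>2) * (1 - (cmod z)\<^sup>2)"
    by (simp add: cmod_one_minus_mult_cnj_sq)
  moreover have "0 < (cmod (1 - z * cnj z))\<^sup>2"
    using one_minus_mult_cnj_pos[OF assms assms] by simp
  ultimately have "sech_sq z z = 1"
    unfolding sech_sq_def by (metis divide_self less_irrefl)
  then show ?thesis by (simp add: reg_green_def)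
qed

text \<open>
  Write $a = (1 - |z|^2)(1 - |w|^2)$ and $e = |z - w|^2$.  Then $|1 - z \bar w|^2 = e + a$, so that
  twice the difference is $\ln (1 + (1 - \kappa) a / e)$, which is at most $(1 - \kappa) / e$.
\<close>

lemma reg_green_approx:
  assumes z: "cmod z < 1" and w: "cmod w < 1" and d: "0 < d" "d \<le> cmod (z - w)"
    and \<kappa>: "0 \<le> \<kappa>" "\<kappa> < 1"
  shows "\<bar>reg_green \<kappa> z w - green z w\<bar> \<le> (1 - \<kappa>) / (2 * d\<^sup>2)"
proof -
  define a where "a = (1 - (cmod z)\<^sup>2) * (1 - (cmod w)\<^sup>2)"
  define e where "e = (cmod (z - w))\<^sup>2"
  have "(cmod z)\<^sup>2 \<le> 1" "(cmod w)\<^sup>2 \<le> 1"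
    using z w by (simp_all add: power_le_one)
  then have a: "0 \<le> a" "a \<le> 1"
    by (auto simp: a_def intro: mult_le_one)
  have "0 < d\<^sup>2" using d by simp
  moreover have "d\<^sup>2 \<le> e" using d by (simp add: e_def power_mono)
  ultimately have e: "0 < e" "d\<^sup>2 \<le> e" by linarith+
  have B: "(cmod (1 - z * cnj w))\<^sup>2 = e + a"
    by (simp add: cmod_one_minus_mult_cnj_sq a_def e_def)
  have s: "sech_sq z w = a / (e + a)"
    by (simp add: sech_sq_def B flip: a_def)
  have "2 * green z w = ln ((cmod (1 - z * cnj w))\<^sup>2) - ln ((cmod (z - w))\<^sup>2)"
    using one_minus_mult_cnj_pos[OF z w] d by (simp add: green_def ln_realpow)
  then have g: "2 * green z w = ln (e + a) - ln e"
    by (simp only: B e_def)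
  have q: "1 - \<kappa> * sech_sq z w = (e + (1 - \<kappa>) * a) / (e + a)"
    using e a by (simp add: s field_simps)
  have p: "0 < e + (1 - \<kappa>) * a"
    using e a \<kappa> by (simp add: add_pos_nonneg)
  have "2 * reg_green \<kappa> z w = ln (e + a) - ln (e + (1 - \<kappa>) * a)"
    using e a p by (simp add: reg_green_def q ln_div)
  with g have "2 * (green z w - reg_green \<kappa> z w) = ln ((e + (1 - \<kappa>) * a) / e)"
    using e p by (simp add: ln_div)
  also have "(e + (1 - \<kappa>) * a) / e = 1 + (1 - \<kappa>) * a / e"
    using e by (simp add: field_simps)
  finally have eq: "2 * (green z w - reg_green \<kappa> z w) = ln (1 + (1 - \<kappa>) * a / e)" .
  have x0: "0 \<le> (1 - \<kappa>) * a / e" using e a \<kappa> by simp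
  have "(1 - \<kappa>) * a / e \<le> (1 - \<kappa>) * 1 / d\<^sup>2"
    using e a \<kappa> d by (intro frac_le mult_left_mono) auto
  moreover have "0 \<le> ln (1 + (1 - \<kappa>) * a / e)" "ln (1 + (1 - \<kappa>) * a / e) \<le> (1 - \<kappa>) * a / e"
    using x0 by (simp_all add: ln_add_one_self_le_self)
  ultimately show ?thesis using eq by (simp add: abs_if field_simps)
qed

section \<open>Onsager's inequality in the disc\<close>

text \<open>
  The parameter $1 - m^{-3}$ balances two errors.  The $m$ diagonal terms contribute
  $\frac32 m \ln m$, which is negligible against the number $m^2$ of all terms, and points of the same
  circle, at distance at least of order $1/m$, feel an error of order $m^{-3} m^2 = m^{-1}$ only.
\<close>

definition circle_energy :: "nat \<Rightarrow> complex \<Rightarrow> real \<Rightarrow> complex \<Rightarrow> real \<Rightarrow> real" where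
  "circle_energy m z r w s = (\<Sum>\<alpha>\<in>unity_roots m. \<Sum>\<beta>\<in>unity_roots m.
     reg_green (1 - 1 / real m ^ 3) (z + of_real r * \<alpha>) (w + of_real s * \<beta>))"

lemma limit_from_error:
  fixes S :: "nat \<Rightarrow> real"
  assumes "\<And>m. 0 < m \<Longrightarrow> \<bar>S m - (real m)\<^sup>2 * K\<bar> \<le> real m * (3 * ln (real m) + C)"
  shows "(\<lambda>m. S m / (real m)\<^sup>2) \<longlonglongrightarrow> K"
proof -
  have lim: "(\<lambda>m. (3 * ln (real m) + C) / real m) \<longlonglongrightarrow> 0"
    by real_asymp
  have "\<forall>\<^sub>F m in sequentially. norm (S m / (real m)\<^sup>2 - K) \<le> (3 * ln (real m) + C) / real m"
    using eventually_gt_at_top[of 0]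
  proof eventually_elim
    case (elim m)
    have "S m / (real m)\<^sup>2 - K = (S m - (real m)\<^sup>2 * K) / (real m)\<^sup>2"
      using elim by (simp add: field_simps)
    then have "norm (S m / (real m)\<^sup>2 - K) = \<bar>S m - (real m)\<^sup>2 * K\<bar> / (real m)\<^sup>2"
      by (simp add: abs_divide)
    also have "\<dots> \<le> (real m * (3 * ln (real m) + C)) / (real m)\<^sup>2"
      using assms[OF elim] by (rule divide_right_mono) simp
    also have "\<dots> = (3 * ln (real m) + C) / real m"
      using elim by (simp add: power2_eq_square)
    finally show ?case .
  qed
  then have "(\<lambda>m. S m / (real m)\<^sup>2 - K) \<longlonglongrightarrow> 0"
    by (rule Lim_null_comparison) (rule lim)
  then show ?thesis
    by (simp add: LIM_zero_iff)
qed

lemma regularization_parameter: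
  assumes "0 < m"
  shows "0 \<le> 1 - 1 / real m ^ 3" "1 - 1 / real m ^ 3 < 1"
  using assms by (simp_all add: one_le_power)

text \<open>
  Points on the two circles keep half the distance of the centres, so the regularisation is harmless,
  and the mean value property applies to one variable of Green's function after the other.
\<close>

lemma circle_energy_distinct:
  assumes z: "cmod z < 1" "0 \<le> r" "2 * r \<le> 1 - cmod z"
    and w: "cmod w < 1" "0 \<le> s" "2 * s \<le> 1 - cmod w"
    and sep: "z \<noteq> w" "2 * (r + s) \<le> cmod (z - w)"
  shows "(\<lambda>m. circle_energy m z r w s / (real m)\<^sup>2) \<longlonglongrightarrow> green z w"
proof -
  define d where "d = cmod (z - w) / 2"
  have d: "0 < d" using sep by (simp add: d_def)
  show ?thesis
  proof (rule limit_from_error[where C = "1 / (2 * d\<^sup>2) + 4"])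
    fix m :: nat assume m: "0 < m"
    let ?R = "unity_roots m" and ?\<kappa> = "1 - 1 / real m ^ 3"
    let ?p = "\<lambda>\<alpha>. z + of_real r * \<alpha>" and ?q = "\<lambda>\<beta>. w + of_real s * \<beta>"
    have approx: "\<bar>reg_green ?\<kappa> (?p \<alpha>) (?q \<beta>) - green (?p \<alpha>) (?q \<beta>)\<bar> \<le> 1 / (2 * d\<^sup>2) / real m"
      if \<alpha>: "\<alpha> \<in> ?R" and \<beta>: "\<beta> \<in> ?R" for \<alpha> \<beta>
    proof -
      have "cmod (z - w) = cmod ((?p \<alpha> - ?q \<beta>) + (of_real s * \<beta> - of_real r * \<alpha>))" by simp
      also have "\<dots> \<le> cmod (?p \<alpha> - ?q \<beta>) + cmod (of_real s * \<beta> - of_real r * \<alpha>)"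
        by (rule norm_triangle_ineq)
      also have "cmod (of_real s * \<beta> - of_real r * \<alpha>) \<le> s + r"
        using norm_triangle_ineq4[of "of_real s * \<beta>" "of_real r * \<alpha>"] z(2) w(2)
          norm_unity_roots[OF m \<alpha>] norm_unity_roots[OF m \<beta>] by (simp add: norm_mult)
      finally have "d \<le> cmod (?p \<alpha> - ?q \<beta>)"
        using sep(2) by (simp add: d_def field_simps)
      then have "\<bar>reg_green ?\<kappa> (?p \<alpha>) (?q \<beta>) - green (?p \<alpha>) (?q \<beta>)\<bar> \<le> (1 - ?\<kappa>) / (2 * d\<^sup>2)"
        using regularization_parameter[OF m] d
        by (intro reg_green_approx circle_in_disc(2)[OF m z(2,3,1) \<alpha>] circle_in_disc(2)[OF m w(2,3,1) \<beta>])
      also have "\<dots> = 1 / (2 * d\<^sup>2) / real m ^ 3" by simp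
      also have "\<dots> \<le> 1 / (2 * d\<^sup>2) / real m"
        using m by (intro divide_left_mono self_le_power) auto
      finally show ?thesis .
    qed
    define G where "G \<alpha> \<beta> = green (?p \<alpha>) (?q \<beta>)" for \<alpha> \<beta>
    have "\<bar>circle_energy m z r w s - (\<Sum>\<alpha>\<in>?R. \<Sum>\<beta>\<in>?R. G \<alpha> \<beta>)\<bar>
        = \<bar>\<Sum>\<alpha>\<in>?R. \<Sum>\<beta>\<in>?R. reg_green ?\<kappa> (?p \<alpha>) (?q \<beta>) - green (?p \<alpha>) (?q \<beta>)\<bar>"
      by (simp add: circle_energy_def sum_subtractf G_def)
    also have "\<dots> \<le> (\<Sum>\<alpha>\<in>?R. \<Sum>\<beta>\<in>?R. 1 / (2 * d\<^sup>2) / real m)"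
      by (intro order_trans[OF sum_abs] sum_mono approx)
    also have "\<dots> = real m * (1 / (2 * d\<^sup>2))"
      using m by simp
    finally have e1: "\<bar>circle_energy m z r w s - (\<Sum>\<alpha>\<in>?R. \<Sum>\<beta>\<in>?R. G \<alpha> \<beta>)\<bar> \<le> real m * (1 / (2 * d\<^sup>2))" .
    have "(\<Sum>\<alpha>\<in>?R. \<Sum>\<beta>\<in>?R. G \<alpha> \<beta>) - (real m)\<^sup>2 * green z w =
        ((\<Sum>\<alpha>\<in>?R. \<Sum>\<beta>\<in>?R. ln (cmod (1 - ?p \<alpha> * cnj (?q \<beta>)))) - (real m)\<^sup>2 * ln (cmod (1 - z * cnj w)))
        - ((\<Sum>\<alpha>\<in>?R. \<Sum>\<beta>\<in>?R. ln (cmod (?p \<alpha> - ?q \<beta>))) - (real m)\<^sup>2 * ln (cmod (z - w)))"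
      by (simp only: G_def green_def sum_subtractf right_diff_distrib)
    with sum_ln_image_bound[OF m z w] sum_ln_dist_bound[OF m z(2) w(2) sep]
    have e2: "\<bar>(\<Sum>\<alpha>\<in>?R. \<Sum>\<beta>\<in>?R. G \<alpha> \<beta>) - (real m)\<^sup>2 * green z w\<bar> \<le> 4 * real m"
      by linarith
    have "0 \<le> real m * (3 * ln (real m))" using m by simp
    then have "real m * (1 / (2 * d\<^sup>2)) + 4 * real m \<le> real m * (3 * ln (real m) + (1 / (2 * d\<^sup>2) + 4))"
      unfolding distrib_left by linarith
    with e1 e2 show "\<bar>circle_energy m z r w s - (real m)\<^sup>2 * green z w\<bar>
        \<le> real m * (3 * ln (real m) + (1 / (2 * d\<^sup>2) + 4))"
      by linarith
  qed
qed

text \<open>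
  The image part of Green's function averages to its value at the centre as before.  The logarithmic
  part contributes the logarithm of the radius, which is the energy of a uniformly charged circle.
\<close>

lemma circle_energy_self:
  assumes z: "cmod z < 1" "0 < r" "2 * r \<le> 1 - cmod z"
  shows "(\<lambda>m. circle_energy m z r z r / (real m)\<^sup>2) \<longlonglongrightarrow> ln ((1 - (cmod z)\<^sup>2) / r)"
proof -
  define c where "c = 1 - ln ((1 - cmod z) / 2)"
  have r0: "0 \<le> r" using z by simp
  have conf: "cmod (1 - z * cnj z) = 1 - (cmod z)\<^sup>2"
  proof -
    have "1 - z * cnj z = of_real (1 - (cmod z)\<^sup>2)"
      by (simp only: of_real_diff of_real_1 complex_norm_square)
    moreover have "(cmod z)\<^sup>2 \<le> 1" using z(1) by (simp add: power_le_one)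
    ultimately show ?thesis by (simp only: norm_of_real)
  qed
  then have pos: "0 < 1 - (cmod z)\<^sup>2"
    using one_minus_mult_cnj_pos[OF z(1) z(1)] by simp
  show ?thesis
  proof (rule limit_from_error[where C = "1 / (2 * r\<^sup>2) + 2 + c + \<bar>ln r\<bar>"])
    fix m :: nat assume m: "0 < m"
    let ?R = "unity_roots m" and ?\<kappa> = "1 - 1 / real m ^ 3"
    let ?p = "\<lambda>\<alpha>. z + of_real r * \<alpha>"
    have p: "cmod (?p \<alpha>) < 1" "cmod (?p \<alpha>) \<le> 1 - (1 - cmod z) / 2" if "\<alpha> \<in> ?R" for \<alpha>
      using circle_in_disc[OF m r0 z(3,1) that] by auto
    define G where "G \<alpha> \<beta> = green (?p \<alpha>) (?p \<beta>)" for \<alpha> \<beta>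
    define H where "H \<alpha> \<beta> = reg_green ?\<kappa> (?p \<alpha>) (?p \<beta>)" for \<alpha> \<beta>
    define L where "L \<alpha> \<beta> = ln (cmod (1 - ?p \<alpha> * cnj (?p \<beta>)))" for \<alpha> \<beta>
    define D where "D \<alpha> \<beta> = ln (cmod (?p \<alpha> - ?p \<beta>))" for \<alpha> \<beta>
    have split: "(\<Sum>\<alpha>\<in>?R. \<Sum>\<beta>\<in>?R. f \<alpha> \<beta>) = (\<Sum>\<alpha>\<in>?R. f \<alpha> \<alpha>) + (\<Sum>\<alpha>\<in>?R. \<Sum>\<beta>\<in>?R - {\<alpha>}. f \<alpha> \<beta>)"
      for f :: "complex \<Rightarrow> complex \<Rightarrow> real"
      unfolding sum.distrib[symmetric] using m by (intro sum.cong refl sum.remove) auto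
    \<comment> \<open>The gap of order $1/m$ between roots of unity, squared, is compensated by $1 - \kappa = m^{-3}$.\<close>
    have approx: "\<bar>H \<alpha> \<beta> - G \<alpha> \<beta>\<bar> \<le> 1 / (2 * r\<^sup>2) / real m"
      if \<alpha>: "\<alpha> \<in> ?R" and \<beta>: "\<beta> \<in> ?R" and ne: "\<alpha> \<noteq> \<beta>" for \<alpha> \<beta>
    proof -
      have "?p \<alpha> - ?p \<beta> = of_real r * (\<alpha> - \<beta>)" by (simp add: algebra_simps)
      then have "cmod (?p \<alpha> - ?p \<beta>) = r * cmod (\<alpha> - \<beta>)"
        using r0 by (simp only: norm_mult norm_of_real abs_of_nonneg)
      moreover have "r * (1 / real m) \<le> r * cmod (\<alpha> - \<beta>)"
        by (intro mult_left_mono unity_roots_gap m \<alpha> \<beta> ne r0)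
      ultimately have "r / real m \<le> cmod (?p \<alpha> - ?p \<beta>)" by simp
      moreover have "0 < r / real m" using z m by simp
      ultimately have "\<bar>H \<alpha> \<beta> - G \<alpha> \<beta>\<bar> \<le> (1 - ?\<kappa>) / (2 * (r / real m)\<^sup>2)"
        unfolding H_def G_def using regularization_parameter[OF m]
        by (intro reg_green_approx p \<alpha> \<beta>)
      also have "\<dots> = 1 / (2 * r\<^sup>2) / real m"
        using m z by (simp add: field_simps power2_eq_square power3_eq_cube)
      finally show ?thesis .
    qed
    have "\<bar>\<Sum>\<alpha>\<in>?R. \<Sum>\<beta>\<in>?R - {\<alpha>}. H \<alpha> \<beta> - G \<alpha> \<beta>\<bar> \<le> (\<Sum>\<alpha>\<in>?R. \<Sum>\<beta>\<in>?R - {\<alpha>}. 1 / (2 * r\<^sup>2) / real m)"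
      by (intro order_trans[OF sum_abs] sum_mono approx) auto
    also have "\<dots> \<le> (\<Sum>\<alpha>\<in>?R. \<Sum>\<beta>\<in>?R. 1 / (2 * r\<^sup>2) / real m)"
      using m by (intro sum_mono sum_mono2) auto
    also have "\<dots> = real m * (1 / (2 * r\<^sup>2))"
      using m by simp
    finally have e1: "\<bar>(\<Sum>\<alpha>\<in>?R. \<Sum>\<beta>\<in>?R - {\<alpha>}. H \<alpha> \<beta>) - (\<Sum>\<alpha>\<in>?R. \<Sum>\<beta>\<in>?R - {\<alpha>}. G \<alpha> \<beta>)\<bar>
        \<le> real m * (1 / (2 * r\<^sup>2))"
      by (simp only: sum_subtractf)
    have e2: "\<bar>(\<Sum>\<alpha>\<in>?R. \<Sum>\<beta>\<in>?R. L \<alpha> \<beta>) - (real m)\<^sup>2 * ln (1 - (cmod z)\<^sup>2)\<bar> \<le> 2 * real m"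
      using sum_ln_image_bound[OF m z(1) r0 z(3) z(1) r0 z(3)] by (simp only: conf L_def)
    have L: "\<bar>L \<alpha> \<alpha>\<bar> \<le> c" if "\<alpha> \<in> ?R" for \<alpha>
    proof -
      have lo: "(1 - cmod z) / 2 \<le> cmod (1 - ?p \<alpha> * cnj (?p \<alpha>))"
        using one_minus_mult_cnj_bound[of "?p \<alpha>" "?p \<alpha>"] p[OF that] by linarith
      have "cmod (?p \<alpha> * cnj (?p \<alpha>)) \<le> 1"
        unfolding norm_mult complex_mod_cnj using p(1)[OF that] by (intro mult_le_one) auto
      then have hi: "cmod (1 - ?p \<alpha> * cnj (?p \<alpha>)) \<le> 2"
        using norm_triangle_ineq4[of 1 "?p \<alpha> * cnj (?p \<alpha>)"] by simp
      have z2: "0 < (1 - cmod z) / 2" using z by simp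
      have "ln ((1 - cmod z) / 2) \<le> L \<alpha> \<alpha>"
        unfolding L_def by (rule ln_mono) (use lo z2 in linarith)+
      moreover have "L \<alpha> \<alpha> \<le> ln 2"
        unfolding L_def by (rule ln_mono) (use lo hi z2 in linarith)+
      moreover have "ln ((1 - cmod z) / 2) \<le> 0"
      proof -
        have "- 1 \<le> cmod z" by (rule order_trans[OF _ norm_ge_zero]) simp
        with z2 show ?thesis by (subst ln_le_zero_iff) auto
      qed
      ultimately show ?thesis
        using ln_2_less_1 unfolding c_def by linarith
    qed
    have "\<bar>\<Sum>\<alpha>\<in>?R. L \<alpha> \<alpha>\<bar> \<le> (\<Sum>\<alpha>\<in>?R. c)"
      by (intro order_trans[OF sum_abs] sum_mono L)
    then have e3: "\<bar>\<Sum>\<alpha>\<in>?R. L \<alpha> \<alpha>\<bar> \<le> real m * c"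
      using m by simp
    have diag: "(\<Sum>\<alpha>\<in>?R. H \<alpha> \<alpha>) = real m * (3 / 2 * ln (real m))"
    proof -
      have "H \<alpha> \<alpha> = 3 / 2 * ln (real m)" if "\<alpha> \<in> ?R" for \<alpha>
        using m by (simp add: H_def reg_green_diag[OF p(1)[OF that]] ln_div ln_realpow)
      then have "(\<Sum>\<alpha>\<in>?R. H \<alpha> \<alpha>) = (\<Sum>\<alpha>\<in>?R. 3 / 2 * ln (real m))"
        by (intro sum.cong refl)
      then show ?thesis using m by simp
    qed
    have "(\<Sum>\<alpha>\<in>?R. \<Sum>\<beta>\<in>?R - {\<alpha>}. G \<alpha> \<beta>)
        = (\<Sum>\<alpha>\<in>?R. \<Sum>\<beta>\<in>?R - {\<alpha>}. L \<alpha> \<beta>) - (\<Sum>\<alpha>\<in>?R. \<Sum>\<beta>\<in>?R - {\<alpha>}. D \<alpha> \<beta>)"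
      by (simp only: G_def L_def D_def green_def sum_subtractf)
    also have "(\<Sum>\<alpha>\<in>?R. \<Sum>\<beta>\<in>?R - {\<alpha>}. D \<alpha> \<beta>) = real m * ((real m - 1) * ln r + ln (real m))"
      unfolding D_def by (rule sum_ln_self_dist[OF m z(2)])
    finally have off: "(\<Sum>\<alpha>\<in>?R. \<Sum>\<beta>\<in>?R - {\<alpha>}. G \<alpha> \<beta>)
        = (\<Sum>\<alpha>\<in>?R. \<Sum>\<beta>\<in>?R. L \<alpha> \<beta>) - (\<Sum>\<alpha>\<in>?R. L \<alpha> \<alpha>)
          - real m * ((real m - 1) * ln r + ln (real m))"
      unfolding split[of L] by simp
    have "circle_energy m z r z r = (\<Sum>\<alpha>\<in>?R. \<Sum>\<beta>\<in>?R. H \<alpha> \<beta>)"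
      by (simp only: circle_energy_def H_def)
    then have E: "circle_energy m z r z r = real m * (3 / 2 * ln (real m)) + (\<Sum>\<alpha>\<in>?R. \<Sum>\<beta>\<in>?R - {\<alpha>}. H \<alpha> \<beta>)"
      by (simp only: split[of H] diag)
    have K: "(real m)\<^sup>2 * ln ((1 - (cmod z)\<^sup>2) / r) = (real m)\<^sup>2 * ln (1 - (cmod z)\<^sup>2) - (real m)\<^sup>2 * ln r"
      using pos z by (simp add: ln_div right_diff_distrib)
    have A: "real m * ((real m - 1) * ln r + ln (real m)) = (real m)\<^sup>2 * ln r - real m * ln r + real m * ln (real m)"
      by (simp add: algebra_simps power2_eq_square)
    have "\<bar>real m * ln r\<bar> = real m * \<bar>ln r\<bar>" by (simp add: abs_mult)
    moreover have "0 \<le> real m * ln (real m)" using m by simp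
    moreover have "real m * (3 * ln (real m) + (1 / (2 * r\<^sup>2) + 2 + c + \<bar>ln r\<bar>))
        = 3 * (real m * ln (real m)) + real m * (1 / (2 * r\<^sup>2)) + 2 * real m + real m * c + real m * \<bar>ln r\<bar>"
      by (simp add: algebra_simps)
    moreover have "real m * (3 / 2 * ln (real m)) = 3 / 2 * (real m * ln (real m))" by simp
    ultimately show "\<bar>circle_energy m z r z r - (real m)\<^sup>2 * ln ((1 - (cmod z)\<^sup>2) / r)\<bar>
        \<le> real m * (3 * ln (real m) + (1 / (2 * r\<^sup>2) + 2 + c + \<bar>ln r\<bar>))"
      using e1 e2 e3 off E K A by linarith
  qed
qed

text \<open>
  Onsager's inequality for the disc: the right-hand side is the energy of the charges spread over
  circles, and it is the limit of the energies of point charges on the circles, each of which is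
  nonnegative by positive definiteness.
\<close>

lemma onsager_disc:
  fixes z :: "'i \<Rightarrow> complex" and q r :: "'i \<Rightarrow> real"
  assumes J: "finite J"
    and z: "\<And>j. j \<in> J \<Longrightarrow> cmod (z j) < 1"
    and r: "\<And>j. j \<in> J \<Longrightarrow> 0 < r j" "\<And>j. j \<in> J \<Longrightarrow> 2 * r j \<le> 1 - cmod (z j)"
    and sep: "\<And>j k. j \<in> J \<Longrightarrow> k \<in> J \<Longrightarrow> j \<noteq> k \<Longrightarrow> 2 * (r j + r k) \<le> cmod (z j - z k)"
  shows "0 \<le> (\<Sum>j\<in>J. \<Sum>k\<in>J. q j * q k *
      (if j = k then ln ((1 - (cmod (z j))\<^sup>2) / r j) else green (z j) (z k)))"
proof -
  define E where "E m j k = circle_energy m (z j) (r j) (z k) (r k)" for m j k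
  have lim: "(\<lambda>m. E m j k / (real m)\<^sup>2) \<longlonglongrightarrow>
      (if j = k then ln ((1 - (cmod (z j))\<^sup>2) / r j) else green (z j) (z k))"
    if j: "j \<in> J" and k: "k \<in> J" for j k
  proof (cases "j = k")
    case True
    then show ?thesis
      using circle_energy_self[OF z[OF j] r(1)[OF j] r(2)[OF j]] by (simp add: E_def)
  next
    case False
    have "0 < 2 * (r j + r k)" using r(1)[OF j] r(1)[OF k] by simp
    then have "0 < cmod (z j - z k)" using sep[OF j k False] by (rule less_le_trans)
    then have "z j \<noteq> z k" by auto
    from circle_energy_distinct[OF z[OF j] less_imp_le[OF r(1)[OF j]] r(2)[OF j]
        z[OF k] less_imp_le[OF r(1)[OF k]] r(2)[OF k] this sep[OF j k False]]
    show ?thesis using False by (simp add: E_def)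
  qed
  have "(\<lambda>m. \<Sum>j\<in>J. \<Sum>k\<in>J. q j * q k * (E m j k / (real m)\<^sup>2)) \<longlonglongrightarrow>
      (\<Sum>j\<in>J. \<Sum>k\<in>J. q j * q k *
      (if j = k then ln ((1 - (cmod (z j))\<^sup>2) / r j) else green (z j) (z k)))"
    by (intro tendsto_sum tendsto_mult_left lim)
  moreover have "\<forall>\<^sub>F m in sequentially. 0 \<le> (\<Sum>j\<in>J. \<Sum>k\<in>J. q j * q k * (E m j k / (real m)\<^sup>2))"
    using eventually_gt_at_top[of 0]
  proof eventually_elim
    case (elim m)
    let ?R = "unity_roots m"
    let ?p = "\<lambda>(j, \<alpha>). z j + of_real (r j) * \<alpha>"
    have "0 \<le> (\<Sum>a\<in>J \<times> ?R. \<Sum>b\<in>J \<times> ?R. q (fst a) * q (fst b) * reg_green (1 - 1 / real m ^ 3) (?p a) (?p b))"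
      using z r regularization_parameter[OF elim] circle_in_disc(2)[OF elim]
      by (intro reg_green_psd) (auto simp: less_imp_le)
    also have "\<dots> = (\<Sum>j\<in>J. \<Sum>\<alpha>\<in>?R. \<Sum>k\<in>J. \<Sum>\<beta>\<in>?R. q j * q k *
        reg_green (1 - 1 / real m ^ 3) (z j + of_real (r j) * \<alpha>) (z k + of_real (r k) * \<beta>))"
      by (simp add: sum.cartesian_product')
    also have "\<dots> = (\<Sum>j\<in>J. \<Sum>k\<in>J. q j * q k * E m j k)"
      by (subst sum.swap[of _ _ ?R]) (simp add: E_def circle_energy_def sum_distrib_left)
    finally have "0 \<le> (\<Sum>j\<in>J. \<Sum>k\<in>J. q j * q k * E m j k) / (real m)\<^sup>2" by simp
    then show ?case by (simp add: sum_divide_distrib)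
  qed
  ultimately show ?thesis
    by (rule tendsto_lowerbound) simp
qed

section \<open>Distortion of conformal maps onto the disc\<close>

text \<open>
  If $w$ lies in the disc of radius $1 - |z|$ around $z$, this is the Schwarz lemma for
  $g - g(z)$ on that disc; otherwise $|w - z| \ge 1 - |z|$ and the bound on the increments suffices.
\<close>

lemma schwarz_increment:
  assumes hol: "g holomorphic_on ball 0 1" and D: "0 < D"
    and bound: "\<And>u v. cmod u < 1 \<Longrightarrow> cmod v < 1 \<Longrightarrow> cmod (g u - g v) < D"
    and z: "cmod z < 1" and w: "cmod w < 1"
  shows "cmod (g w - g z) * (1 - cmod z) \<le> D * cmod (w - z)"
proof (cases "cmod (w - z) < 1 - cmod z")
  case False
  then show ?thesis
    using bound[OF w z] z D by (intro mult_mono) auto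
next
  case True
  define R where "R = 1 - cmod z"
  have R: "0 < R" using z by (simp add: R_def)
  define h where "h \<zeta> = (g (z + of_real R * \<zeta>) - g z) / of_real D" for \<zeta>
  have inside: "cmod (z + of_real R * \<zeta>) < 1" if "cmod \<zeta> < 1" for \<zeta>
  proof -
    have "R * cmod \<zeta> < R" using that R by simp
    have "cmod (z + of_real R * \<zeta>) \<le> cmod z + R * cmod \<zeta>"
      using norm_triangle_ineq[of z "of_real R * \<zeta>"] R by (simp add: norm_mult)
    also have "\<dots> < cmod z + R" using \<open>R * cmod \<zeta> < R\<close> by simp
    finally show ?thesis by (simp add: R_def)
  qed
  define \<xi> where "\<xi> = (w - z) / of_real R"
  have \<xi>: "cmod \<xi> < 1" using True R unfolding R_def[symmetric] by (simp add: \<xi>_def norm_divide)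
  have "h holomorphic_on ball 0 1"
    unfolding h_def using D inside
    by (intro holomorphic_intros holomorphic_on_compose_gen[OF _ hol, unfolded o_def]) auto
  moreover have "h 0 = 0" by (simp add: h_def)
  moreover have "cmod (h \<zeta>) < 1" if "cmod \<zeta> < 1" for \<zeta>
    using bound[OF inside[OF that] z] D by (simp add: h_def norm_divide)
  ultimately have "cmod (h \<xi>) \<le> cmod \<xi>"
    using \<xi> by (intro Schwarz_Lemma(1)) auto
  moreover have "z + of_real R * \<xi> = w" using R by (simp add: \<xi>_def)
  ultimately have "cmod (g w - g z) / D \<le> cmod (w - z) / R"
    using D R by (simp add: h_def \<xi>_def norm_divide)
  then show ?thesis
    using D R by (simp add: field_simps flip: R_def)
qed

lemma conformal_bijection_distortion:
  assumes "open U" and \<phi>: "conformal_bijection \<phi> U (ball 0 1)"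
    and D: "0 < D" "\<And>u v. u \<in> U \<Longrightarrow> v \<in> U \<Longrightarrow> cmod (u - v) < D"
    and xy: "x \<in> U" "y \<in> U"
  shows "cmod (x - y) * (1 - cmod (\<phi> x)) \<le> D * cmod (\<phi> x - \<phi> y)"
proof -
  have hol: "\<phi> holomorphic_on U" and inj: "inj_on \<phi> U" and img: "\<phi> ` U = ball 0 1"
    using \<phi> by (auto simp: conformal_bijection_def bij_betw_def)
  obtain g where g: "g holomorphic_on \<phi> ` U" "\<And>u. u \<in> U \<Longrightarrow> g (\<phi> u) = u"
    using holomorphic_has_inverse[OF hol \<open>open U\<close> inj] by metis
  have bound: "cmod (g u - g v) < D" if "cmod u < 1" "cmod v < 1" for u v
  proof -
    have "u \<in> \<phi> ` U" "v \<in> \<phi> ` U" using that img by auto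
    then show ?thesis using D(2) g(2) by auto
  qed
  have "cmod (\<phi> x) < 1" "cmod (\<phi> y) < 1" using img xy by auto
  from schwarz_increment[OF g(1)[unfolded img] D(1) bound this]
  show ?thesis using g(2) xy by (simp add: norm_minus_commute)
qed

section \<open>The inequality on a bounded domain\<close>

lemma green_commute: "green z w = green w z"
proof -
  have "cmod (1 - z * cnj w) = cmod (1 - w * cnj z)"
    using complex_mod_cnj[of "1 - z * cnj w"] by (simp add: mult.commute)
  then show ?thesis by (simp add: green_def norm_minus_commute)
qed

lemma gff_cov_eq_green:
  assumes "cmod (\<phi> x) < 1" "cmod (\<phi> y) < 1" "\<phi> x \<noteq> \<phi> y"
  shows "gff_cov \<phi> x y = green (\<phi> x) (\<phi> y)"
  unfolding gff_cov_def green_def norm_divide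
  using assms one_minus_mult_cnj_pos[OF assms(1,2)] by (simp add: ln_div)

lemma sum_offdiag_symmetric:
  fixes f :: "nat \<Rightarrow> nat \<Rightarrow> real"
  assumes "\<And>j k. f j k = f k j"
  shows "(\<Sum>j=1..N. \<Sum>k=1..N. f j k) = (\<Sum>j=1..N. f j j) + 2 * (\<Sum>j=1..N. \<Sum>k\<in>{j<..N}. f j k)"
proof (induction N)
  case (Suc N)
  have "{j<..Suc N} = insert (Suc N) {j<..N}" if "j \<in> {1..N}" for j using that by auto
  then have "(\<Sum>j=1..N. \<Sum>k\<in>{j<..Suc N}. f j k) = (\<Sum>j=1..N. f j (Suc N) + (\<Sum>k\<in>{j<..N}. f j k))"
    by (intro sum.cong) auto
  then have "(\<Sum>j=1..Suc N. \<Sum>k\<in>{j<..Suc N}. f j k)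
      = (\<Sum>j=1..N. f j (Suc N)) + (\<Sum>j=1..N. \<Sum>k\<in>{j<..N}. f j k)"
    by (simp add: sum.distrib)
  moreover have "(\<Sum>j=1..N. f (Suc N) j) = (\<Sum>j=1..N. f j (Suc N))"
    by (intro sum.cong assms refl)
  ultimately show ?case using Suc by (simp add: sum.distrib)
qed simp

theorem proposition3p9:
  fixes U :: "complex set"
  assumes "open U" and "U \<noteq> {}" and "connected U" and "simply_connected U" and "bounded U"
  shows "\<exists>C::real. C > 0 \<and>
    (\<forall>\<phi>. conformal_bijection \<phi> U (ball 0 1) \<longrightarrow>
      (\<forall>(N::nat) (q::nat \<Rightarrow> real) (x::nat \<Rightarrow> complex).
        N \<ge> 2 \<longrightarrow> (\<forall>j\<in>{1..N}. q j \<in> {-1, 1}) \<longrightarrow> (\<forall>j\<in>{1..N}. x j \<in> U) \<longrightarrow> inj_on x {1..N} \<longrightarrow>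
        - (\<Sum>j=1..N. \<Sum>k\<in>{j<..N}. q j * q k * gff_cov \<phi> (x j) (x k))
        \<le> 1/2 * (\<Sum>j=1..N. ln (1 / (1/2 * Min ((\<lambda>k. cmod (x j - x k)) ` ({1..N} - {j})))))
          + C * real N))"
proof -
  obtain b where b: "0 < b" "\<And>u. u \<in> U \<Longrightarrow> cmod u < b"
    using \<open>bounded U\<close> unfolding bounded_pos_less by blast
  \<comment> \<open>The Schwarz lemma asks for a strict bound, hence the summand 1; it also makes the constant positive.\<close>
  define D where "D = 2 * b + 1"
  have D: "1 < D" "0 < D" using b by (simp_all add: D_def)
  have diam: "cmod (u - v) < D" if "u \<in> U" "v \<in> U" for u v
    using norm_triangle_ineq4[of u v] b(2)[OF that(1)] b(2)[OF that(2)] by (simp add: D_def)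
  define C where "C = ln (8 * D) / 2"
  have "0 < C" unfolding C_def using D by simp
  show ?thesis
  proof (intro exI conjI allI impI)
    show "0 < C" by fact
    fix \<phi> N and q :: "nat \<Rightarrow> real" and x :: "nat \<Rightarrow> complex"
    assume \<phi>: "conformal_bijection \<phi> U (ball 0 1)" and N: "2 \<le> N"
      and q: "\<forall>j\<in>{1..N}. q j \<in> {-1, 1}" and x: "\<forall>j\<in>{1..N}. x j \<in> U" and inj: "inj_on x {1..N}"
    define J where "J = {1..N}"
    define z where "z j = \<phi> (x j)" for j
    define \<mu> where "\<mu> j = 1/2 * Min ((\<lambda>k. cmod (x j - x k)) ` (J - {j}))" for j
    define d where "d j = Min ((\<lambda>k. cmod (z j - z k)) ` (J - {j}))" for j
    \<comment> \<open>The energy estimate needs room for circles of twice this size, hence the divisors 4 and 2.\<close>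
    define r where "r j = min (d j / 4) ((1 - cmod (z j)) / 2)" for j
    have fin: "finite J" and card: "card J = N" by (simp_all add: J_def)
    have ne: "J - {j} \<noteq> {}" for j
    proof
      assume "J - {j} = {}"
      then have "card J \<le> card {j}" by (intro card_mono) auto
      then show False using N card by simp
    qed
    have img: "\<phi> ` U = ball 0 1" and inj\<phi>: "inj_on \<phi> U"
      using \<phi> by (auto simp: conformal_bijection_def bij_betw_def)
    have xU: "x j \<in> U" if "j \<in> J" for j
      using x that by (simp add: J_def)
    have z1: "cmod (z j) < 1" if "j \<in> J" for j
    proof -
      have "z j \<in> ball 0 1" unfolding z_def img[symmetric] by (intro imageI xU that)
      then show ?thesis by simp
    qed
    have injx: "x j \<noteq> x k" if "j \<in> J" "k \<in> J" "j \<noteq> k" for j k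
      using inj_onD[OF inj] that unfolding J_def by blast
    have injz: "z j \<noteq> z k" if "j \<in> J" "k \<in> J" "j \<noteq> k" for j k
      using inj_onD[OF inj\<phi>] injx[OF that] xU that unfolding z_def by blast
    have d_le: "d j \<le> cmod (z j - z k)" if "k \<in> J" "j \<noteq> k" for j k
      unfolding d_def by (rule Min_le) (use that fin in auto)
    have d_pos: "0 < d j" if "j \<in> J" for j
      unfolding d_def by (subst Min_gr_iff) (use that fin ne[of j] injz in auto)
    have \<mu>_le: "2 * \<mu> j \<le> cmod (x j - x k)" if "k \<in> J" "j \<noteq> k" for j k
    proof -
      have "Min ((\<lambda>k. cmod (x j - x k)) ` (J - {j})) \<le> cmod (x j - x k)"
        by (rule Min_le) (use that fin in auto)
      then show ?thesis by (simp add: \<mu>_def)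
    qed
    have \<mu>_pos: "0 < \<mu> j" if "j \<in> J" for j
    proof -
      have "0 < Min ((\<lambda>k. cmod (x j - x k)) ` (J - {j}))"
        by (subst Min_gr_iff) (use that fin ne[of j] injx in auto)
      then show ?thesis by (simp add: \<mu>_def)
    qed
    have r_pos: "0 < r j" if "j \<in> J" for j
      using d_pos[OF that] z1[OF that] by (simp add: r_def)
    have r_le: "2 * r j \<le> 1 - cmod (z j)" "4 * r j \<le> d j" for j
      by (simp_all add: r_def min_def)
    have sep: "2 * (r j + r k) \<le> cmod (z j - z k)" if "j \<in> J" "k \<in> J" "j \<noteq> k" for j k
      using r_le(2)[of j] r_le(2)[of k] d_le[OF that(2,3)] d_le[OF that(1) that(3)[symmetric]]
        norm_minus_commute[of "z j" "z k"] by simp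
    have radius: "ln ((1 - (cmod (z j))\<^sup>2) / r j) \<le> ln (1 / \<mu> j) + 2 * C" if j: "j \<in> J" for j
    proof -
      have "d j \<in> (\<lambda>k. cmod (z j - z k)) ` (J - {j})"
        unfolding d_def by (rule Min_in) (use fin ne[of j] in auto)
      then obtain k where k: "k \<in> J" "j \<noteq> k" "d j = cmod (z j - z k)" by blast
      have xjk: "x j \<in> U" "x k \<in> U" by (rule xU, fact)+
      have \<mu>: "2 * \<mu> j \<le> cmod (x j - x k)"
        using k by (intro \<mu>_le) auto
      have t0: "0 \<le> \<mu> j * (1 - cmod (z j))"
        using \<mu>_pos[OF j] z1[OF j] by (intro mult_nonneg_nonneg) auto
      \<comment> \<open>The radius is a minimum: distortion handles the first term, boundedness of the domain the second.\<close>
      have "2 * \<mu> j * (1 - cmod (z j)) \<le> cmod (x j - x k) * (1 - cmod (z j))"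
        using \<mu> z1[OF j] by (intro mult_right_mono) auto
      also have "\<dots> \<le> D * d j"
        using conformal_bijection_distortion[OF \<open>open U\<close> \<phi> D(2) diam xjk] by (simp add: z_def k(3))
      finally have "2 * (\<mu> j * (1 - cmod (z j))) \<le> 4 * D * (d j / 4)" by simp
      with t0 have 1: "\<mu> j * (1 - cmod (z j)) \<le> 4 * D * (d j / 4)" by linarith
      have "2 * \<mu> j \<le> 2 * (2 * D)" using \<mu> diam[OF xjk] D(2) by linarith
      then have "\<mu> j * (1 - cmod (z j)) \<le> (2 * D) * (1 - cmod (z j))"
        using z1[OF j] by (intro mult_right_mono) auto
      then have 2: "\<mu> j * (1 - cmod (z j)) \<le> 4 * D * ((1 - cmod (z j)) / 2)" by simp
      have 3: "\<mu> j * (1 - cmod (z j)) \<le> 4 * D * r j"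
        using 1 2 unfolding r_def min_def by presburger
      have "0 \<le> (1 - cmod (z j))\<^sup>2" by simp
      then have "1 - (cmod (z j))\<^sup>2 \<le> 2 * (1 - cmod (z j))"
        by (simp add: power2_eq_square algebra_simps)
      then have "\<mu> j * (1 - (cmod (z j))\<^sup>2) \<le> \<mu> j * (2 * (1 - cmod (z j)))"
        using \<mu>_pos[OF j] by (intro mult_left_mono) auto
      also have "\<dots> = 2 * (\<mu> j * (1 - cmod (z j)))" by (rule mult.left_commute)
      also have "\<dots> \<le> 2 * (4 * D * r j)" using 3 by (intro mult_left_mono) auto
      finally have "\<mu> j * (1 - (cmod (z j))\<^sup>2) \<le> 8 * D * r j" by simp
      then have "(1 - (cmod (z j))\<^sup>2) / r j \<le> 8 * D / \<mu> j"
        using r_pos[OF j] \<mu>_pos[OF j] by (simp add: field_simps)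
      moreover have "0 < (1 - (cmod (z j))\<^sup>2) / r j"
        using z1[OF j] r_pos[OF j] by (simp add: abs_square_less_1)
      ultimately have "ln ((1 - (cmod (z j))\<^sup>2) / r j) \<le> ln (8 * D / \<mu> j)"
        by (intro ln_mono)
      also have "\<dots> = ln (1 / \<mu> j) + 2 * C"
        using D \<mu>_pos[OF j] by (simp add: C_def ln_div)
      finally show ?thesis .
    qed
    define f where "f j k = q j * q k *
      (if j = k then ln ((1 - (cmod (z j))\<^sup>2) / r j) else green (z j) (z k))" for j k
    have "0 \<le> (\<Sum>j\<in>J. \<Sum>k\<in>J. f j k)"
      unfolding f_def by (rule onsager_disc[OF fin z1 r_pos r_le(1) sep])
    also have "\<dots> = (\<Sum>j\<in>J. f j j) + 2 * (\<Sum>j\<in>J. \<Sum>k\<in>{j<..N}. f j k)"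
      unfolding J_def by (rule sum_offdiag_symmetric) (simp add: f_def green_commute mult.commute)
    also have "(\<Sum>j\<in>J. \<Sum>k\<in>{j<..N}. f j k) = (\<Sum>j\<in>J. \<Sum>k\<in>{j<..N}. q j * q k * gff_cov \<phi> (x j) (x k))"
    proof (intro sum.cong refl)
      fix j k assume jk: "j \<in> J" "k \<in> {j<..N}"
      then have k: "k \<in> J" "j \<noteq> k" by (auto simp: J_def)
      show "f j k = q j * q k * gff_cov \<phi> (x j) (x k)"
        using gff_cov_eq_green[of \<phi> "x j" "x k"] z1[OF jk(1)] z1[OF k(1)] injz[OF jk(1) k] k
        by (simp add: f_def z_def)
    qed
    finally have energy: "- (\<Sum>j\<in>J. \<Sum>k\<in>{j<..N}. q j * q k * gff_cov \<phi> (x j) (x k)) \<le> 1/2 * (\<Sum>j\<in>J. f j j)"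
      by simp
    have "f j j \<le> ln (1 / \<mu> j) + 2 * C" if "j \<in> J" for j
    proof -
      have "q j \<in> {-1, 1}" using q that unfolding J_def by blast
      then have "q j * q j = 1" by auto
      then show ?thesis using radius[OF that] by (simp add: f_def)
    qed
    then have "(\<Sum>j\<in>J. f j j) \<le> (\<Sum>j\<in>J. ln (1 / \<mu> j) + 2 * C)"
      by (intro sum_mono)
    also have "\<dots> = (\<Sum>j\<in>J. ln (1 / \<mu> j)) + 2 * (C * real N)"
      by (simp add: sum.distrib card)
    finally show "- (\<Sum>j=1..N. \<Sum>k\<in>{j<..N}. q j * q k * gff_cov \<phi> (x j) (x k))
        \<le> 1/2 * (\<Sum>j=1..N. ln (1 / (1/2 * Min ((\<lambda>k. cmod (x j - x k)) ` ({1..N} - {j})))))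
          + C * real N"
      using energy unfolding J_def \<mu>_def by linarith
  qed
qed

end
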